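(* Let $y_{ex}\in\mathsf{Im}(A)$, $y_{ex}\neq 0$, and let $x_s\in\mathcal{X}$ be the unique element with $Ax_s=y_{ex}$. For each $\delta>0$ let $y^\delta\in\mathcal{Y}$ satisfy $\|y^\delta-y_{ex}\|_\mathcal{Y}\le\delta$. Then for any $\varepsilon>0$ and any choice of $M(\delta)\in\mathbb{N}$ ($\delta>0$) such that $M(\delta)\to+\infty$ and $\delta\sqrt{M(\delta)}\to 0$ as $\delta\to0$, one has $X_\varepsilon^{M(\delta)}(y^\delta)\to x_s$ strongly in $\mathcal{X}$ as $\delta\to 0$.
   Context: $\mathcal{X},\mathcal{Y}$ are real Hilbert spaces; $A:\mathcal{X}\to\mathcal{Y}$ is a continuous linear operator that is one-to-one, not onto, and has dense range in $\mathcal{Y}$. $b$ is a symmetric non-negative bilinear form on $\mathcal{X}$ with induced seminorm $\|x\|_b=\sqrt{b(x,x)}$, such that there are constants $c,C>0$ with $c^2\|x\|_\mathcal{X}^2\le \|Ax\|_\mathcal{Y}^2+\|x\|_b^2\le C^2\|x\|_\mathcal{X}^2$ for all $x\in\mathcal{X}$. $\mathbb{N}$ contains $0$. Iterated quasi-reversibility: for $\varepsilon>0$ and data $y\in\mathcal{Y}$, define $X_\varepsilon^{-1}(y)=0$ and, for $M\in\mathbb{N}$, $X_\varepsilon^M(y)$ is the unique element of $\mathcal{X}$ such that $$(AX_\varepsilon^M(y),Ax)_\mathcal{Y}+\varepsilon\, b(X_\varepsilon^M(y),x)=(y,Ax)_\mathcal{Y}+\varepsilon\, b(X_\varepsilon^{M-1}(y),x)\quad\forall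 x\in\mathcal{X}.$$ *)

theory Defs
  imports "HOL-Analysis.Analysis"
begin

definition bseminorm :: "('a::real_vector \<Rightarrow> 'a \<Rightarrow> real) \<Rightarrow> 'a \<Rightarrow> real" where
  "bseminorm b x = sqrt (b x x)"

text \<open>
  One quasi-reversibility step: from the previous iterate \<open>w\<close>, the unique solution \<open>z\<close> of the
  variational equation. The description is only meaningful when that solution exists uniquely,
  for instance for complete spaces, \<open>A\<close> bounded and linear, \<open>b\<close> symmetric, bilinear and
  non-negative, \<open>\<epsilon> > 0\<close>, and \<open>\<parallel>A x\<parallel>\<^sup>2 + b x x\<close> equivalent to \<open>\<parallel>x\<parallel>\<^sup>2\<close>.
\<close>

definition qr_step ::
  "('a::real_inner \<Rightarrow> 'b::real_inner) \<Rightarrow> ('a \<Rightarrow> 'a \<Rightarrow> real) \<Rightarrow> real \<Rightarrow> 'b \<Rightarrow> 'a \<Rightarrow> 'a" where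
  "qr_step A b \<epsilon> y w =
     (THE z. \<forall>x. A z \<bullet> A x + \<epsilon> * b z x = y \<bullet> A x + \<epsilon> * b w x)"

text \<open>
  The iteration conventionally starts from the zero vector at index \<open>-1\<close>; hence the iterate
  with index \<open>0\<close> is already the result of one step.
\<close>

primrec iqr ::
  "('a::real_inner \<Rightarrow> 'b::real_inner) \<Rightarrow> ('a \<Rightarrow> 'a \<Rightarrow> real) \<Rightarrow> real \<Rightarrow> 'b \<Rightarrow> nat \<Rightarrow> 'a" where
  "iqr A b \<epsilon> y 0 = qr_step A b \<epsilon> y 0"
| "iqr A b \<epsilon> y (Suc M) = qr_step A b \<epsilon> y (iqr A b \<epsilon> y M)"

end

theory Submission
  imports Defs
begin

text \<open>
  Let \<open>G x x' = A x \<bullet> A x' + \<epsilon> * b x x'\<close>, an inner product equivalent to the given one. The error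
  for exact data satisfies \<open>G e\<^sub>n\<^sub>+\<^sub>1 x = \<epsilon> * b e\<^sub>n x\<close>, so it is the orbit of a \<open>G\<close>-self-adjoint operator
  between \<open>0\<close> and the identity. Hence \<open>G e\<^sub>m e\<^sub>n\<close> depends only on \<open>m + n\<close> and decreases, which makes
  \<open>e\<close> a Cauchy sequence; its limit lies in the kernel of \<open>A\<close>, so it vanishes. The influence of
  noise of size \<open>\<delta>\<close> is controlled by testing the variational equation with its own solution, which
  adds at most \<open>\<delta>\<^sup>2\<close> to the energy \<open>G\<close> in each step: after \<open>M + 1\<close> steps the energy is at most
  \<open>(M + 1) * \<delta>\<^sup>2\<close>.
\<close>

section \<open>Tools for quadratic energies\<close>

lemma Cauchy_if_norm_diff_square_le:
  fixes X :: "nat \<Rightarrow> 'a::real_normed_vector"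
  assumes le: "\<And>m n. \<kappa> * (norm (X m - X n))\<^sup>2 \<le> u m + u n"
    and u: "u \<longlonglongrightarrow> 0" and "0 < \<kappa>"
  shows "Cauchy X"
proof (rule CauchyI)
  fix r :: real
  assume "0 < r"
  with \<open>0 < \<kappa>\<close> have "\<forall>\<^sub>F n in sequentially. u n < \<kappa> * r\<^sup>2 / 2"
    by (intro order_tendstoD(2)[OF u]) simp
  then obtain N where N: "\<And>n. n \<ge> N \<Longrightarrow> u n < \<kappa> * r\<^sup>2 / 2"
    by (auto simp: eventually_sequentially)
  have "norm (X m - X n) < r" if "m \<ge> N" "n \<ge> N" for m n
  proof -
    have "\<kappa> * (norm (X m - X n))\<^sup>2 < \<kappa> * r\<^sup>2"
      using le[of m n] N[OF that(1)] N[OF that(2)] by linarith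
    then show ?thesis
      using \<open>0 < \<kappa>\<close> \<open>0 < r\<close> by (simp add: power_less_imp_less_base)
  qed
  then show "\<exists>N. \<forall>m\<ge>N. \<forall>n\<ge>N. norm (X m - X n) < r"
    by blast
qed

lemma linear_coeff_eq_0_if_quadratic_nonneg:
  fixes p q :: real
  assumes "\<And>t. 0 \<le> t * p + t\<^sup>2 * q"
  shows "p = 0"
proof (rule ccontr)
  assume "p \<noteq> 0"
  \<comment> \<open>With \<open>t = - s * p\<close> the sign is decided by \<open>s * q - 1\<close>;
    the \<open>+ 1\<close> keeps the denominator positive when \<open>q = 0\<close>.\<close>
  define s where "s = 1 / (\<bar>q\<bar> + 1)"
  have s: "0 < s" "s * q < 1"
    unfolding s_def by (auto simp: divide_simps)
  have "0 \<le> (- s * p) * p + (- s * p)\<^sup>2 * q"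
    by (rule assms)
  also have "\<dots> = s * p\<^sup>2 * (s * q - 1)"
    by (simp add: power2_eq_square algebra_simps)
  also have "\<dots> < 0"
    using s \<open>p \<noteq> 0\<close> by (simp add: mult_pos_neg)
  finally show False by simp
qed

lemma bounded_bilinear_add:
  assumes "bounded_bilinear f" and "bounded_bilinear g"
  shows "bounded_bilinear (\<lambda>x y. f x y + g x y)"
proof -
  interpret f: bounded_bilinear f by fact
  interpret g: bounded_bilinear g by fact
  obtain K L where K: "\<And>x y. norm (f x y) \<le> norm x * norm y * K"
    and L: "\<And>x y. norm (g x y) \<le> norm x * norm y * L"
    using f.bounded g.bounded by blast
  show ?thesis
  proof
    have "norm (f x y + g x y) \<le> norm x * norm y * (K + L)" for x y
      unfolding distrib_left by (intro norm_triangle_mono K L)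
    then show "\<exists>K. \<forall>x y. norm (f x y + g x y) \<le> norm x * norm y * K"
      by blast
  qed (simp_all add: f.add_left f.add_right g.add_left g.add_right f.scaleR_left f.scaleR_right
      g.scaleR_left g.scaleR_right algebra_simps)
qed

section \<open>Variational equations and solvability of one step\<close>

text \<open>
  The solution is the minimiser of \<open>G z z - 2 * f z\<close>; minimising sequences are Cauchy by the
  parallelogram law.
\<close>

lemma lax_milgram_symmetric:
  fixes G :: "'a::{real_normed_vector, complete_space} \<Rightarrow> 'a \<Rightarrow> real"
  assumes "bounded_bilinear G" and sym: "\<And>x y. G x y = G y x"
    and "0 < \<kappa>" and coercive: "\<And>x. \<kappa> * (norm x)\<^sup>2 \<le> G x x"
    and "bounded_linear f"
  obtains z where "\<And>x. G z x = f x"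
proof -
  interpret G: bounded_bilinear G by fact
  interpret f: bounded_linear f by fact
  define J where "J z = G z z - 2 * f z" for z
  obtain K where K: "\<And>x. norm (f x) \<le> norm x * K"
    using f.bounded by blast
  have "- (K\<^sup>2 / \<kappa>) \<le> J z" for z
  proof -
    have "0 \<le> (\<kappa> * norm z - K)\<^sup>2 / \<kappa>"
      using \<open>0 < \<kappa>\<close> by simp
    also have "\<dots> = \<kappa> * (norm z)\<^sup>2 - 2 * (norm z * K) + K\<^sup>2 / \<kappa>"
      using \<open>0 < \<kappa>\<close> by (simp add: power2_eq_square field_simps)
    finally show ?thesis
      using coercive[of z] K[of z] unfolding J_def by auto
  qed
  then have bdd: "bdd_below (range J)"
    by (intro bdd_belowI2[of UNIV])
  define m where "m = (INF z. J z)"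
  have m_le: "m \<le> J z" for z
    unfolding m_def by (rule cINF_lower[OF bdd]) simp
  have "\<exists>z. J z < m + inverse (real (Suc n))" for n
    using cINF_less_iff[of UNIV J "m + inverse (real (Suc n))"] bdd by (simp add: m_def)
  then obtain X where X: "\<And>n. J (X n) < m + inverse (real (Suc n))"
    by metis
  have parallelogram: "G (u - v) (u - v) = 2 * J u + 2 * J v - 4 * J ((1/2) *\<^sub>R (u + v))" for u v
    unfolding J_def
    by (simp add: G.add_left G.add_right G.diff_left G.diff_right G.scaleR_left G.scaleR_right
        f.add f.scaleR sym[of v u] algebra_simps)
  have "Cauchy X"
  proof (rule Cauchy_if_norm_diff_square_le[OF _ _ \<open>0 < \<kappa>\<close>])
    show "\<kappa> * (norm (X i - X j))\<^sup>2 \<le> 2 * inverse (real (Suc i)) + 2 * inverse (real (Suc j))" for i j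
      using coercive[of "X i - X j"] parallelogram[of "X i" "X j"] X[of i] X[of j]
        m_le[of "(1/2) *\<^sub>R (X i + X j)"] by simp
    show "(\<lambda>n. 2 * inverse (real (Suc n))) \<longlonglongrightarrow> 0"
      using tendsto_mult_right_zero[OF LIMSEQ_inverse_real_of_nat] .
  qed
  then obtain z where z: "X \<longlonglongrightarrow> z"
    using Cauchy_convergent convergent_def by blast
  have "(\<lambda>n. J (X n)) \<longlonglongrightarrow> J z"
    unfolding J_def by (intro tendsto_intros G.tendsto f.tendsto z)
  moreover have "(\<lambda>n. m + inverse (real (Suc n))) \<longlonglongrightarrow> m"
    by (rule LIMSEQ_inverse_real_of_nat_add)
  ultimately have Jz: "J z \<le> m"
    using X by (intro LIMSEQ_le) (auto intro: less_imp_le)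
  have "G z x = f x" for x
  proof -
    \<comment> \<open>First variation: the quadratic in \<open>t\<close> is
      \<open>J (z + t *\<^sub>R x) - J z\<close>, nonnegative because \<open>z\<close> is a
      minimiser.\<close>
    have "0 \<le> t * (2 * (G z x - f x)) + t\<^sup>2 * G x x" for t
      using m_le[of "z + t *\<^sub>R x"] Jz unfolding J_def
      by (simp add: G.add_left G.add_right G.scaleR_left G.scaleR_right f.add f.scaleR sym[of x z]
          power2_eq_square algebra_simps)
    then show ?thesis
      using linear_coeff_eq_0_if_quadratic_nonneg by force
  qed
  then show thesis by (rule that)
qed

text \<open>For unit vectors, nonnegativity at \<open>x - y\<close> and \<open>x + y\<close> gives
  \<open>2 * \<bar>b x y\<bar> \<le> b x x + b y y \<le> 2 * K\<close>; homogeneity does the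
  rest.\<close>

lemma bounded_bilinear_if_nonneg_form:
  fixes b :: "'a::real_normed_vector \<Rightarrow> 'a \<Rightarrow> real"
  assumes bil: "bilinear b" and sym: "\<And>x y. b x y = b y x" and nonneg: "\<And>x. 0 \<le> b x x"
    and bound: "\<And>x. b x x \<le> K * (norm x)\<^sup>2"
  shows "bounded_bilinear b"
proof
  have le: "\<bar>b x y\<bar> \<le> K" if "norm x = 1" "norm y = 1" for x y
    using nonneg[of "x - y"] nonneg[of "x + y"] bound[of x] bound[of y] sym[of y x] that
    by (simp add: bilinear_lsub[OF bil] bilinear_rsub[OF bil] bilinear_ladd[OF bil] bilinear_radd[OF bil])
  have "norm (b x y) \<le> norm x * norm y * K" for x y
  proof (cases "x = 0 \<or> y = 0")
    case True
    then show ?thesis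
      by (auto simp: bilinear_lzero[OF bil] bilinear_rzero[OF bil])
  next
    case False
    then have "\<bar>b (sgn x) (sgn y)\<bar> \<le> K"
      by (intro le) (auto simp: norm_sgn)
    with False show ?thesis
      by (simp add: sgn_div_norm bilinear_lmul[OF bil] bilinear_rmul[OF bil] abs_mult field_simps)
  qed
  then show "\<exists>K. \<forall>x y. norm (b x y) \<le> norm x * norm y * K"
    by blast
qed (simp_all add: bilinear_ladd[OF bil] bilinear_radd[OF bil] bilinear_lmul[OF bil] bilinear_rmul[OF bil])

text \<open>Coercivity is stated for the \<open>\<epsilon>\<close>-weighted energy, the form
  inverted in each step, so that one constant \<open>\<kappa>\<close> serves existence, uniqueness
  and the error bounds.\<close>

locale quasi_reversibility =
  fixes A :: "'a::{real_inner, complete_space} \<Rightarrow> 'b::real_inner"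
    and b :: "'a \<Rightarrow> 'a \<Rightarrow> real" and \<epsilon> \<kappa> :: real
  assumes linA: "bounded_linear A" and injA: "inj A"
    and bilb: "bounded_bilinear b" and symb: "b x y = b y x" and nonneg: "0 \<le> b x x"
    and eps: "0 < \<epsilon>" and kappa: "0 < \<kappa>"
    and coercive: "\<kappa> * (norm x)\<^sup>2 \<le> A x \<bullet> A x + \<epsilon> * b x x"
begin

sublocale A: bounded_linear A by (rule linA)
sublocale b: bounded_bilinear b by (rule bilb)

lemma two_b_le_add: "2 * b x y \<le> b x x + b y y"
  using nonneg[of "x - y"] by (simp add: b.diff_left b.diff_right symb[of y x])

text \<open>Existence by \<open>lax_milgram_symmetric\<close> and uniqueness by coercivity justify
  the definite description in \<open>qr_step\<close>.\<close>

lemma qr_step_eq: "A (qr_step A b \<epsilon> y w) \<bullet> A x + \<epsilon> * b (qr_step A b \<epsilon> y w) x = y \<bullet> A x + \<epsilon> * b w x"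
proof -
  let ?G = "\<lambda>x y. A x \<bullet> A y + \<epsilon> * b x y"
  let ?f = "\<lambda>x. y \<bullet> A x + \<epsilon> * b w x"
  have "bounded_bilinear (\<lambda>x y. \<epsilon> * b x y)"
    using b.comp1[OF bounded_linear_scaleR_right[of \<epsilon>]] unfolding b.scaleR_left real_scaleR_def .
  then have "bounded_bilinear ?G"
    by (intro bounded_bilinear_add bounded_bilinear.comp[OF bounded_bilinear_inner linA linA])
  moreover have "bounded_linear ?f"
    by (intro bounded_linear_add bounded_linear_const_mult b.bounded_linear_right
        bounded_linear_inner_right_comp linA)
  moreover have "?G u v = ?G v u" for u v
    by (simp add: inner_commute symb[of u v])
  ultimately obtain z where z: "\<And>x. ?G z x = ?f x"
    using lax_milgram_symmetric[of ?G \<kappa> ?f] kappa coercive by blast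
  have "\<exists>!z. \<forall>x. ?G z x = ?f x"
  proof (rule ex1I[of _ z])
    fix v
    assume v: "\<forall>x. ?G v x = ?f x"
    have "?G (v - z) (v - z) = 0"
      using z[of "v - z"] v[rule_format, of "v - z"]
      by (simp add: A.diff b.diff_left inner_diff_left algebra_simps)
    then have "\<kappa> * (norm (v - z))\<^sup>2 \<le> 0"
      using coercive[of "v - z"] by simp
    then show "v = z"
      using kappa by (simp add: mult_le_0_iff)
  qed (use z in blast)
  then have "\<forall>x. ?G (qr_step A b \<epsilon> y w) x = ?f x"
    unfolding qr_step_def by (rule theI')
  then show ?thesis by blast
qed

section \<open>Propagation of noise\<close>

text \<open>Take \<open>x = z\<close> and double the equation: Young's inequality on both right-hand
  products costs one copy of the energy of \<open>z\<close> and leaves the other.\<close>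

lemma noise_energy:
  assumes eq: "\<And>x. A z \<bullet> A x + \<epsilon> * b z x = \<eta> \<bullet> A x + \<epsilon> * b w x"
  shows "A z \<bullet> A z + \<epsilon> * b z z \<le> (norm \<eta>)\<^sup>2 + \<epsilon> * b w w"
proof -
  have "0 \<le> (\<eta> - A z) \<bullet> (\<eta> - A z)"
    by simp
  then have "2 * (\<eta> \<bullet> A z) \<le> (norm \<eta>)\<^sup>2 + A z \<bullet> A z"
    by (simp add: inner_diff_left inner_diff_right inner_commute[of "A z" \<eta>] power2_norm_eq_inner)
  moreover have "\<epsilon> * (2 * b w z) \<le> \<epsilon> * (b w w + b z z)"
    using two_b_le_add eps by (intro mult_left_mono) auto
  ultimately show ?thesis
    using eq[of z] by (simp add: algebra_simps)
qed

lemma iqr_noise: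
  "\<kappa> * (norm (iqr A b \<epsilon> y n - iqr A b \<epsilon> y' n))\<^sup>2 \<le> real (Suc n) * (norm (y - y'))\<^sup>2"
proof -
  define d where "d n = iqr A b \<epsilon> y n - iqr A b \<epsilon> y' n" for n
  have step: "A (qr_step A b \<epsilon> y w - qr_step A b \<epsilon> y' w') \<bullet> A x
      + \<epsilon> * b (qr_step A b \<epsilon> y w - qr_step A b \<epsilon> y' w') x
      = (y - y') \<bullet> A x + \<epsilon> * b (w - w') x" for w w' x
    using qr_step_eq[of y w x] qr_step_eq[of y' w' x]
    by (simp add: A.diff b.diff_left inner_diff_left algebra_simps)
  have "A (d n) \<bullet> A (d n) + \<epsilon> * b (d n) (d n) \<le> real (Suc n) * (norm (y - y'))\<^sup>2"
  proof (induction n)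
    \<comment> \<open>Both iterations start from zero, so no earlier error enters. Index 0 already
      counts one step, whence the factor \<open>Suc n\<close>.\<close>
    case 0
    show ?case
      using noise_energy[OF step, of 0 0] by (simp add: d_def b.zero_left)
  next
    case (Suc n)
    have "A (d (Suc n)) \<bullet> A (d (Suc n)) + \<epsilon> * b (d (Suc n)) (d (Suc n))
        \<le> (norm (y - y'))\<^sup>2 + \<epsilon> * b (d n) (d n)"
      unfolding d_def iqr.simps by (rule noise_energy[OF step])
    \<comment> \<open>Only the \<open>b\<close> part of the old energy is passed on; it is at most
      the whole energy, bounded by induction.\<close>
    also have "\<dots> \<le> (norm (y - y'))\<^sup>2 + real (Suc n) * (norm (y - y'))\<^sup>2"
      using Suc.IH inner_ge_zero[of "A (d n)"] by linarith
    finally show ?case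
      by (simp add: algebra_simps)
  qed
  then show ?thesis
    using coercive[of "d n"] unfolding d_def by linarith
qed

section \<open>Convergence for exact data\<close>

lemma orbit_tendsto_0:
  assumes e: "\<And>n x. A (e (Suc n)) \<bullet> A x + \<epsilon> * b (e (Suc n)) x = \<epsilon> * b (e n) x"
  shows "e \<longlonglongrightarrow> 0"
proof -
  define G where "G x y = A x \<bullet> A y + \<epsilon> * b x y" for x y
  have G_sym: "G x y = G y x" for x y
    unfolding G_def by (simp add: symb[of x y] inner_commute)
  have G_e: "G (e (Suc n)) x = \<epsilon> * b (e n) x" for n x
    unfolding G_def by (rule e)
  have b_le_G: "\<epsilon> * b x x \<le> G x x" for x
    unfolding G_def by simp
  have G_nonneg: "0 \<le> G x x" for x
    unfolding G_def using nonneg eps by simp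
  \<comment> \<open>Both sides equal \<open>\<epsilon> * b (e m) (e n)\<close>; this is the
    self-adjointness of the error propagation.\<close>
  have shift: "G (e (Suc m)) (e n) = G (e m) (e (Suc n))" for m n
    using G_e[of m "e n"] G_e[of n "e m"] symb[of "e m" "e n"] G_sym[of "e m"] by simp
  define a where "a n = G (e n) (e 0)" for n
  have G_a: "G (e m) (e n) = a (m + n)" for m n
    by (induction n arbitrary: m) (simp_all add: a_def flip: shift)
  have a_dec_even: "a (Suc (2 * n)) \<le> a (2 * n)" for n
    using b_le_G[of "e n"] G_e[of n "e n"] by (simp add: G_a mult_2)
  \<comment> \<open>Young's inequality for neighbouring iterates bounds twice the left side by the
    sum of both sides.\<close>
  have a_dec_odd: "a (Suc (Suc (2 * n))) \<le> a (Suc (2 * n))" for n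
  proof -
    have "\<epsilon> * (2 * b (e n) (e (Suc n))) \<le> \<epsilon> * (b (e n) (e n) + b (e (Suc n)) (e (Suc n)))"
      using two_b_le_add eps by (intro mult_left_mono) auto
    moreover have "\<epsilon> * b (e n) (e n) = a (Suc (2 * n))"
      using G_e[of n "e n"] by (simp add: G_a mult_2)
    moreover have "\<epsilon> * b (e n) (e (Suc n)) = a (Suc (Suc (2 * n)))"
      using G_e[of n "e (Suc n)"] by (simp add: G_a mult_2)
    moreover have "\<epsilon> * b (e (Suc n)) (e (Suc n)) \<le> a (Suc (Suc (2 * n)))"
      using b_le_G[of "e (Suc n)"] by (simp add: G_a mult_2)
    ultimately show ?thesis
      by (simp add: distrib_left)
  qed
  have "a (Suc n) \<le> a n" for n
    by (cases "even n") (auto elim!: evenE oddE simp: a_dec_even a_dec_odd)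
  then have "decseq a"
    by (rule decseq_SucI)
  moreover have a_even_nonneg: "0 \<le> a (2 * n)" for n
    using G_nonneg[of "e n"] by (simp add: G_a mult_2)
  \<comment> \<open>Whatever the parity of \<open>n\<close>, \<open>a n\<close> dominates the
    squared \<open>G\<close>-norm \<open>a (2 * n)\<close>.\<close>
  have "0 \<le> a n" for n
    using a_even_nonneg[of n] decseqD[OF \<open>decseq a\<close>, of n "2 * n"] by simp
  ultimately obtain L where L: "a \<longlonglongrightarrow> L" "\<And>n. L \<le> a n"
    using decseq_convergent by metis
  have "Cauchy e"
  proof (rule Cauchy_if_norm_diff_square_le[OF _ _ kappa])
    fix m n
    have "\<kappa> * (norm (e m - e n))\<^sup>2 \<le> G (e m - e n) (e m - e n)"
      unfolding G_def by (rule coercive)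
    also have "\<dots> = G (e m) (e m) - G (e m) (e n) - G (e n) (e m) + G (e n) (e n)"
      unfolding G_def
      by (simp add: A.diff b.diff_left b.diff_right inner_diff_left inner_diff_right algebra_simps)
    also have "\<dots> = a (2 * m) + a (2 * n) - 2 * a (m + n)"
      unfolding G_a mult_2 add.commute[of n m] by simp
    \<comment> \<open>The bound \<open>L \<le> a (m + n)\<close> replaces the mixed term and so
      separates \<open>m\<close> from \<open>n\<close>.\<close>
    finally show "\<kappa> * (norm (e m - e n))\<^sup>2 \<le> (a (2 * m) - L) + (a (2 * n) - L)"
      using L(2)[of "m + n"] by simp
    show "(\<lambda>n. a (2 * n) - L) \<longlonglongrightarrow> 0"
      using LIMSEQ_subseq_LIMSEQ[OF L(1), of "\<lambda>n. 2 * n"]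
      by (auto simp: strict_mono_def o_def LIM_zero)
  qed
  then obtain l where l: "e \<longlonglongrightarrow> l"
    using Cauchy_convergent convergent_def by blast
  \<comment> \<open>In the limit of the recursion tested with \<open>l\<close> the \<open>b\<close>
    terms cancel, which leaves \<open>A l \<bullet> A l = 0\<close>.\<close>
  have "(\<lambda>n. A (e (Suc n)) \<bullet> A l + \<epsilon> * b (e (Suc n)) l) \<longlonglongrightarrow> A l \<bullet> A l + \<epsilon> * b l l"
    by (intro tendsto_intros A.tendsto b.tendsto LIMSEQ_Suc l)
  moreover have "(\<lambda>n. \<epsilon> * b (e n) l) \<longlonglongrightarrow> \<epsilon> * b l l"
    by (intro tendsto_intros b.tendsto l)
  ultimately have "A l \<bullet> A l + \<epsilon> * b l l = \<epsilon> * b l l"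
    unfolding e by (rule LIMSEQ_unique)
  then have "A l = A 0"
    by (simp add: A.zero)
  with l show ?thesis
    using injD[OF injA] by blast
qed

text \<open>For data \<open>A x\<close> the vector \<open>x\<close> is a fixed point of the step, so
  the error obeys the homogeneous recursion.\<close>

lemma iqr_exact_tendsto: "iqr A b \<epsilon> (A x) \<longlonglongrightarrow> x"
proof -
  have "(\<lambda>n. iqr A b \<epsilon> (A x) n - x) \<longlonglongrightarrow> 0"
  proof (rule orbit_tendsto_0)
    show "A (iqr A b \<epsilon> (A x) (Suc n) - x) \<bullet> A v + \<epsilon> * b (iqr A b \<epsilon> (A x) (Suc n) - x) v
        = \<epsilon> * b (iqr A b \<epsilon> (A x) n - x) v" for n v
      using qr_step_eq[of "A x" "iqr A b \<epsilon> (A x) n" v]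
      by (simp add: A.diff b.diff_left inner_diff_left algebra_simps)
  qed
  then show ?thesis
    by (rule LIM_zero_cancel)
qed

section \<open>Noisy data and the stopping index\<close>

text \<open>Split at the iterate for the exact data \<open>A x\<close>: \<open>iqr_noise\<close>
  squeezes the difference, and the rest converges along \<open>M\<close>.\<close>

lemma iqr_tendsto:
  assumes M: "filterlim M at_top F"
    and noise: "((\<lambda>\<delta>. real (Suc (M \<delta>)) * (norm (y \<delta> - A x))\<^sup>2) \<longlongrightarrow> 0) F"
  shows "((\<lambda>\<delta>. iqr A b \<epsilon> (y \<delta>) (M \<delta>)) \<longlongrightarrow> x) F"
proof -
  let ?d = "\<lambda>\<delta>. iqr A b \<epsilon> (y \<delta>) (M \<delta>) - iqr A b \<epsilon> (A x) (M \<delta>)"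
  have "((\<lambda>\<delta>. sqrt (real (Suc (M \<delta>)) * (norm (y \<delta> - A x))\<^sup>2 / \<kappa>)) \<longlongrightarrow> sqrt (0 / \<kappa>)) F"
    using kappa by (intro tendsto_intros noise) simp
  moreover have "norm (?d \<delta>) \<le> sqrt (real (Suc (M \<delta>)) * (norm (y \<delta> - A x))\<^sup>2 / \<kappa>)" for \<delta>
    using iqr_noise[of "y \<delta>" "M \<delta>" "A x"] kappa
    by (intro real_le_rsqrt) (simp add: pos_le_divide_eq mult.commute)
  ultimately have "(?d \<longlongrightarrow> 0) F"
    by (intro Lim_null_comparison[where f = ?d]) auto
  moreover have "((\<lambda>\<delta>. iqr A b \<epsilon> (A x) (M \<delta>)) \<longlongrightarrow> x) F"
    by (rule filterlim_compose[OF iqr_exact_tendsto M])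
  ultimately show ?thesis
    using tendsto_add by fastforce
qed

end

theorem proposition13:
  fixes A :: "'a::{real_inner, complete_space} \<Rightarrow> 'b::{real_inner, complete_space}"
    and b :: "'a \<Rightarrow> 'a \<Rightarrow> real"
    and c C \<epsilon> :: real
    and y_ex :: 'b and x_s :: 'a
    and y\<delta> :: "real \<Rightarrow> 'b"
    and M :: "real \<Rightarrow> nat"
  assumes "bounded_linear A" and "inj A" and "\<not> surj A" and "closure (range A) = UNIV"
    and "bilinear b" and "\<And>x x'. b x x' = b x' x" and "\<And>x. 0 \<le> b x x"
    and "0 < c" and "0 < C"
    and "\<And>x. c\<^sup>2 * (norm x)\<^sup>2 \<le> (norm (A x))\<^sup>2 + (bseminorm b x)\<^sup>2"
    and "\<And>x. (norm (A x))\<^sup>2 + (bseminorm b x)\<^sup>2 \<le> C\<^sup>2 * (norm x)\<^sup>2"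
    and "y_ex \<in> range A" and "y_ex \<noteq> 0" and "A x_s = y_ex"
    and "\<And>\<delta>. 0 < \<delta> \<Longrightarrow> norm (y\<delta> \<delta> - y_ex) \<le> \<delta>"
    and "0 < \<epsilon>"
    and "filterlim M at_top (at_right 0)"
    and "((\<lambda>\<delta>. \<delta> * sqrt (real (M \<delta>))) \<longlongrightarrow> 0) (at_right 0)"
  shows "((\<lambda>\<delta>. iqr A b \<epsilon> (y\<delta> \<delta>) (M \<delta>)) \<longlongrightarrow> x_s) (at_right 0)"
proof -
  have sq: "(bseminorm b x)\<^sup>2 = b x x" for x
    using assms(7) by (simp add: bseminorm_def)
  \<comment> \<open>The factor \<open>min 1 \<epsilon>\<close> pays for passing from weight 1 to
    weight \<open>\<epsilon>\<close> on \<open>b\<close>.\<close>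
  define \<kappa> where "\<kappa> = min 1 \<epsilon> * c\<^sup>2"
  interpret quasi_reversibility A b \<epsilon> \<kappa>
  proof (rule quasi_reversibility.intro)
    have "b x x \<le> C\<^sup>2 * (norm x)\<^sup>2" for x
      using assms(11)[of x] sq[of x] zero_le_power2[of "norm (A x)"] by linarith
    then show "bounded_bilinear b"
      by (rule bounded_bilinear_if_nonneg_form[OF assms(5,6,7)])
    show "0 < \<kappa>"
      using \<open>0 < c\<close> \<open>0 < \<epsilon>\<close> by (simp add: \<kappa>_def)
    show "\<kappa> * (norm x)\<^sup>2 \<le> A x \<bullet> A x + \<epsilon> * b x x" for x
    proof -
      have "\<kappa> * (norm x)\<^sup>2 = min 1 \<epsilon> * (c\<^sup>2 * (norm x)\<^sup>2)"
        by (simp add: \<kappa>_def)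
      also have "\<dots> \<le> min 1 \<epsilon> * (A x \<bullet> A x + b x x)"
        using assms(10)[of x] \<open>0 < \<epsilon>\<close> by (intro mult_left_mono) (auto simp: sq power2_norm_eq_inner)
      also have "\<dots> \<le> 1 * (A x \<bullet> A x) + \<epsilon> * b x x"
        unfolding distrib_left using assms(7)[of x] by (intro add_mono mult_right_mono) auto
      finally show ?thesis by simp
    qed
  qed (use assms in auto)
  \<comment> \<open>These squares add up to
    \<open>real (Suc (M \<delta>)) * \<delta>\<^sup>2\<close>; the second belongs to the extra step
    due to the start at index -1.\<close>
  have "((\<lambda>\<delta>. (\<delta> * sqrt (real (M \<delta>)))\<^sup>2 + \<delta>\<^sup>2) \<longlongrightarrow> 0\<^sup>2 + 0\<^sup>2) (at_right 0)"
    by (intro tendsto_intros assms(18))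
  then have lim: "((\<lambda>\<delta>. real (Suc (M \<delta>)) * \<delta>\<^sup>2) \<longlongrightarrow> 0) (at_right 0)"
    by (simp add: power_mult_distrib algebra_simps)
  \<comment> \<open>The noise bound is available only for positive \<open>\<delta>\<close>, hence
    the eventual form.\<close>
  have le: "\<forall>\<^sub>F \<delta> in at_right 0.
      norm (real (Suc (M \<delta>)) * (norm (y\<delta> \<delta> - A x_s))\<^sup>2) \<le> real (Suc (M \<delta>)) * \<delta>\<^sup>2"
    using eventually_at_right_less[of "0::real"]
    by eventually_elim
      (use assms(14,15) in \<open>auto simp del: of_nat_Suc intro!: mult_left_mono power_mono\<close>)
  show ?thesis
    by (intro iqr_tendsto assms(17) Lim_null_comparison[OF le lim])
qed

end
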